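(* Let $f:\mathbb{R}^n\to\mathbb{R}$ be $L$-smooth and $\mu$-strongly convex ($\mu>0$) with minimizer $x^*$. Let $\varepsilon>0$, let $y_0\in\mathbb{R}^n$ with $\|\nabla f(y_0)\|>\varepsilon$, and let $\mu_0\ge\mu$ and $0<M_0\le4L$. Then the algorithm $\mathrm{SCAR}(f,\varepsilon,y_0,\mu_0,M_0)$ (described in the context) terminates with $\|\nabla f(\hat x)\|\le\varepsilon$. The total number of gradient evaluations is bounded by $$(4+8\sqrt5\,C_1)\left\lceil\log_4\frac{\mu_0}{\mu}\right\rceil\sqrt{\frac L\mu}+(4+8\sqrt5\,C_1)\sqrt{\frac L\mu}\left\lceil\log_2\frac{\|\nabla f(y_0)\|}{\varepsilon}\right\rceil .$$ Moreover, if $\mu_0\le2^j\varepsilon/\|y_0-x^*\|$ for some integer $j$, an alternative bound on the number of gradient evaluations is $$(4+8\sqrt5\,C_1)\left\lceil\log_4\frac{\mu_0}{\mu}\right\rceil\sqrt{\frac L\mu}+\left(4+C_1\sqrt{\frac{10L}{\mu}}\right)\max\{1,j\}.$$ Here $C_1:=\sqrt2\,(3+16\sqrt{2c_{\mathcal A}})$.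
   Context: $\|\cdot\|$ is the Euclidean norm. $L$-smooth means differentiable with $\|\nabla f(x)-\nabla f(y)\|\le L\|x-y\|$ for all $x,y$; $\mu$-strongly convex means $f(x)\ge f(y)+\langle\nabla f(y),x-y\rangle+\frac\mu2\|x-y\|^2$ for all $x,y$. Backtracking$(g,\sigma,x,M_0)$: for $j=0,1,\dots$ set $x^{++}=x-\frac{1}{2(M_j+\sigma)}\nabla g(x)$; if $g(x^{++})-g(x)-\langle\nabla g(x),x^{++}-x\rangle\le\frac{M_j+\sigma}{2}\|x^{++}-x\|^2$, terminate and return $M=M_j$; otherwise set $M_{j+1}=2M_j$. (Only one gradient, at $x$, is used.) AR method $(\hat x,M)=\mathrm{AR}(f,x_0,\sigma_1,M_0)$: set $\overline{x}_0=x_0$, $\sigma_0=0$. For $s=1,2,\dots$: if $s>1$ set $\sigma_s=4\sigma_{s-1}$; set $\overline{x}_s=(1-\gamma_s)\overline{x}_{s-1}+\gamma_sx_{s-1}$ with $\gamma_s=1-\sigma_{s-1}/\sigma_s$; compute an approximate solution $x_s=\mathcal{A}(f,\sigma_s,\overline{x}_s,x_{s-1})$ of $x_s^*:=\operatorname{argmin}_{x\in\mathbb{R}^n}\{f_s(x):=f(x)+\frac{\sigma_s}{2}\|x-\overline{x}_s\|^2\}$; set $M_s=\text{Backtracking}(f_s,\sigma_s,x_s,M_{s-1}/2)$; if $\sigma_s\ge M_s$, terminate with $\hat x=x_s$, $M=M_s$. Assumption on the subroutine $\mathcal{A}$: after its $k$-th gradient evaluation of $\nabla f$ it has computed an approximate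 solution $x_s^k$ and an estimate $L_s^k\le c_{\mathcal A}L$ with $f_s(x_s^k)-f_s(x_s^* )\le\frac{L_s^k}{k^2}\|x_{s-1}-x_s^*\|^2$, where $c_{\mathcal A}$ is a universal constant depending on $\mathcal{A}$; it terminates whenever $k\ge8\sqrt{2L_s^k/\sigma_s}$ and outputs $x_s=x_s^k$. SCAR algorithm $(\hat x,\hat M)=\mathrm{SCAR}(f,\varepsilon,y_0,\mu_0,M_0)$: for $t=1,2,\dots$: set $(y_t,M_t)=\mathrm{AR}(f,y_{t-1},\mu_{t-1}/10,M_{t-1})$; if $\|\nabla f(y_t)\|>\|\nabla f(y_{t-1})\|/2$, set $\mu_t=\mu_{t-1}/4$ and reset $y_t=y_{t-1}$ (otherwise $\mu_t=\mu_{t-1}$); if $\|\nabla f(y_t)\|\le\varepsilon$, terminate with $\hat x=y_t$, $\hat M=M_t$. *)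

theory Defs
  imports "HOL-Analysis.Analysis"
begin

definition grad :: "('a::euclidean_space \<Rightarrow> real) \<Rightarrow> 'a \<Rightarrow> 'a" where
  "grad f x = (THE D. GDERIV f x :> D)"

definition smooth_with :: "real \<Rightarrow> ('a::euclidean_space \<Rightarrow> real) \<Rightarrow> bool" where
  "smooth_with L f \<longleftrightarrow>
     (\<forall>x. f differentiable (at x)) \<and>
     (\<forall>x y. norm (grad f x - grad f y) \<le> L * norm (x - y))"

definition strongly_convex_with :: "real \<Rightarrow> ('a::euclidean_space \<Rightarrow> real) \<Rightarrow> bool" where
  "strongly_convex_with \<mu> f \<longleftrightarrow>
     (\<forall>x y. f x \<ge> f y + grad f y \<bullet> (x - y) + \<mu> / 2 * (norm (x - y))\<^sup>2)"

definition regularized :: "('a::euclidean_space \<Rightarrow> real) \<Rightarrow> real \<Rightarrow> 'a \<Rightarrow> 'a \<Rightarrow> real" where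
  "regularized f \<sigma> xb x = f x + \<sigma> / 2 * (norm (x - xb))\<^sup>2"

definition prox_point :: "('a::euclidean_space \<Rightarrow> real) \<Rightarrow> real \<Rightarrow> 'a \<Rightarrow> 'a" where
  "prox_point f \<sigma> xb = (ARG_MIN (regularized f \<sigma> xb) x. True)"

text \<open>
  The algorithms are given as big-step relations between inputs, outputs and
  the number of evaluations of the gradient of f; a derivation exists exactly when the
  (deterministic) execution terminates.
\<close>

definition backtracking_test :: "('a::euclidean_space \<Rightarrow> real) \<Rightarrow> real \<Rightarrow> 'a \<Rightarrow> real \<Rightarrow> bool" where
  "backtracking_test g \<sigma> x M \<longleftrightarrow>
     (let x' = x - (1 / (2 * (M + \<sigma>))) *\<^sub>R grad g x
      in g x' - g x - grad g x \<bullet> (x' - x) \<le> (M + \<sigma>) / 2 * (norm (x' - x))\<^sup>2)"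

inductive backtracking :: "('a::euclidean_space \<Rightarrow> real) \<Rightarrow> real \<Rightarrow> 'a \<Rightarrow> real \<Rightarrow> real \<Rightarrow> bool"
  for g \<sigma> x where
  backtracking_stop:
    "backtracking_test g \<sigma> x M \<Longrightarrow> backtracking g \<sigma> x M M"
| backtracking_step:
    "\<not> backtracking_test g \<sigma> x M \<Longrightarrow> backtracking g \<sigma> x (2 * M) M' \<Longrightarrow> backtracking g \<sigma> x M M'"

text \<open>
  The subroutine is a black box: for the call with arguments f, \<open>\<sigma>\<close>, \<open>xb\<close>, \<open>x\<close>, the pair
  \<open>\<A> f \<sigma> xb x k\<close> consists of the approximate solution and the smoothness estimate that
  are available after the k-th gradient evaluation (\<open>k \<ge> 1\<close>; the value at
  \<open>k = 0\<close> is irrelevant).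
\<close>

type_synonym 'a subroutine = "('a \<Rightarrow> real) \<Rightarrow> real \<Rightarrow> 'a \<Rightarrow> 'a \<Rightarrow> nat \<Rightarrow> 'a \<times> real"

definition subroutine_guarantee ::
    "'a::euclidean_space subroutine \<Rightarrow> real \<Rightarrow> ('a \<Rightarrow> real) \<Rightarrow> real \<Rightarrow> bool" where
  "subroutine_guarantee \<A> c f L \<longleftrightarrow>
     (\<forall>\<sigma> xb x k. \<sigma> > 0 \<longrightarrow> k \<ge> 1 \<longrightarrow>
        (let (xk, Lk) = \<A> f \<sigma> xb x k; xs = prox_point f \<sigma> xb
         in Lk \<le> c * L \<and>
            regularized f \<sigma> xb xk - regularized f \<sigma> xb xs
              \<le> Lk / (real k)\<^sup>2 * (norm (x - xs))\<^sup>2))"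

definition subroutine_test ::
    "'a::euclidean_space subroutine \<Rightarrow> ('a \<Rightarrow> real) \<Rightarrow> real \<Rightarrow> 'a \<Rightarrow> 'a \<Rightarrow> nat \<Rightarrow> bool" where
  "subroutine_test \<A> f \<sigma> xb x k \<longleftrightarrow> real k \<ge> 8 * sqrt (2 * snd (\<A> f \<sigma> xb x k) / \<sigma>)"

definition subroutine_run ::
    "'a::euclidean_space subroutine \<Rightarrow> ('a \<Rightarrow> real) \<Rightarrow> real \<Rightarrow> 'a \<Rightarrow> 'a \<Rightarrow> 'a \<Rightarrow> nat \<Rightarrow> bool" where
  "subroutine_run \<A> f \<sigma> xb x z k \<longleftrightarrow>
     k \<ge> 1 \<and> subroutine_test \<A> f \<sigma> xb x k \<and> (\<forall>i\<in>{1..<k}. \<not> subroutine_test \<A> f \<sigma> xb x i) \<and>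
     z = fst (\<A> f \<sigma> xb x k)"

text \<open>
  In \<open>AR_from \<A> f \<sigma>' \<sigma> xb' x' M' xh Mh N\<close> the primed values belong to index s - 1 and
  \<open>\<sigma>\<close> is the regularization parameter of iteration s, where execution starts.
  Each iteration costs the k evaluations of the subroutine and one for backtracking:
  the gradient of the regularized function at x requires only that of f at x.
\<close>

inductive AR_from ::
    "'a::euclidean_space subroutine \<Rightarrow> ('a \<Rightarrow> real) \<Rightarrow> real \<Rightarrow> real \<Rightarrow> 'a \<Rightarrow> 'a \<Rightarrow> real \<Rightarrow>
     'a \<Rightarrow> real \<Rightarrow> nat \<Rightarrow> bool"
  for \<A> f where
  AR_stop:
    "\<lbrakk>\<gamma> = 1 - \<sigma>' / \<sigma>; xb = (1 - \<gamma>) *\<^sub>R xb' + \<gamma> *\<^sub>R x';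
      subroutine_run \<A> f \<sigma> xb x' x k;
      backtracking (regularized f \<sigma> xb) \<sigma> x (M' / 2) M;
      \<sigma> \<ge> M\<rbrakk>
     \<Longrightarrow> AR_from \<A> f \<sigma>' \<sigma> xb' x' M' x M (k + 1)"
| AR_step:
    "\<lbrakk>\<gamma> = 1 - \<sigma>' / \<sigma>; xb = (1 - \<gamma>) *\<^sub>R xb' + \<gamma> *\<^sub>R x';
      subroutine_run \<A> f \<sigma> xb x' x k;
      backtracking (regularized f \<sigma> xb) \<sigma> x (M' / 2) M;
      \<not> \<sigma> \<ge> M;
      AR_from \<A> f \<sigma> (4 * \<sigma>) xb x M xh Mh N\<rbrakk>
     \<Longrightarrow> AR_from \<A> f \<sigma>' \<sigma> xb' x' M' xh Mh (k + 1 + N)"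

definition AR ::
    "'a::euclidean_space subroutine \<Rightarrow> ('a \<Rightarrow> real) \<Rightarrow> 'a \<Rightarrow> real \<Rightarrow> real \<Rightarrow>
     'a \<Rightarrow> real \<Rightarrow> nat \<Rightarrow> bool" where
  "AR \<A> f x0 \<sigma>1 M0 xh Mh N \<longleftrightarrow> AR_from \<A> f 0 \<sigma>1 x0 x0 M0 xh Mh N"

text \<open>
  The tests of the outer loop cost nothing extra: the gradient of f at the output of AR was
  already evaluated by the last call of backtracking, and that at the current
  point is known. Only the gradient at the starting point must be added, which is
  done in \<open>SCAR\<close>.
\<close>

inductive SCAR_from ::
    "'a::euclidean_space subroutine \<Rightarrow> ('a \<Rightarrow> real) \<Rightarrow> real \<Rightarrow> 'a \<Rightarrow> real \<Rightarrow> real \<Rightarrow>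
     'a \<Rightarrow> real \<Rightarrow> nat \<Rightarrow> bool"
  for \<A> f \<epsilon> where
  SCAR_stop:
    "\<lbrakk>AR \<A> f y (\<mu> / 10) M z M' k;
      (y', \<mu>') = (if norm (grad f z) > norm (grad f y) / 2 then (y, \<mu> / 4) else (z, \<mu>));
      norm (grad f y') \<le> \<epsilon>\<rbrakk>
     \<Longrightarrow> SCAR_from \<A> f \<epsilon> y \<mu> M y' M' k"
| SCAR_step:
    "\<lbrakk>AR \<A> f y (\<mu> / 10) M z M' k;
      (y', \<mu>') = (if norm (grad f z) > norm (grad f y) / 2 then (y, \<mu> / 4) else (z, \<mu>));
      \<not> norm (grad f y') \<le> \<epsilon>;
      SCAR_from \<A> f \<epsilon> y' \<mu>' M' xh Mh N\<rbrakk>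
     \<Longrightarrow> SCAR_from \<A> f \<epsilon> y \<mu> M xh Mh (k + N)"

definition SCAR ::
    "'a::euclidean_space subroutine \<Rightarrow> ('a \<Rightarrow> real) \<Rightarrow> real \<Rightarrow> 'a \<Rightarrow> real \<Rightarrow> real \<Rightarrow>
     'a \<Rightarrow> real \<Rightarrow> nat \<Rightarrow> bool" where
  "SCAR \<A> f \<epsilon> y0 \<mu>0 M0 xh Mh N \<longleftrightarrow> (\<exists>N'. SCAR_from \<A> f \<epsilon> y0 \<mu>0 M0 xh Mh N' \<and> N = 1 + N')"

definition C1 :: "real \<Rightarrow> real" where
  "C1 c = sqrt 2 * (3 + 16 * sqrt (2 * c))"

end

theory Submission imports Defs begin

text \<open>
  Accumulative regularization rests on one identity: the quadratic terms of the successive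
  subproblems satisfy \<open>\<sigma> xb = \<sigma>' xb' + (\<sigma> - \<sigma>') x'\<close>, so passing to the next subproblem only adds
  a multiple of the squared distance to the last iterate \<open>x'\<close>. That addition cannot push the
  minimizer away from \<open>x'\<close> (\<open>minimizer_moves_towards_center\<close>), while the subroutine divides the
  distance to the current minimizer by 8 (\<open>subroutine_contraction\<close>). Hence the distances shrink by
  8 per iteration whereas \<open>\<sigma>\<close> grows by 4 only, and the products of \<open>\<sigma>\<close> with the distances
  form a geometric series. Because the gradient of f at the output is the gradient of the last
  subproblem minus \<open>\<sigma> (x - xb)\<close>, and both are controlled by that series, the output of AR has
  gradient norm at most \<open>5/2 \<sigma>\<^sub>1\<close> times the distance of the start to the minimizer
  (\<open>AR_from_grad_bound\<close>).

  The cost of AR is governed by \<open>a = sqrt (2 L / \<sigma>)\<close>, which is halved in each iteration. The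
  subroutine costs a multiple of \<open>a\<close>, and backtracking never returns more than \<open>2 L\<close>, so AR
  stops at the latest when \<open>a \<le> 1\<close>. The total is again a geometric series (\<open>AR_from_cost\<close>).

  In SCAR, a call with estimate \<open>m \<le> 2 \<mu>\<close> starts AR with \<open>\<sigma>\<^sub>1 = m / 10 \<le> \<mu> / 5\<close> and therefore halves
  the gradient, because the distance to the minimizer is at most the gradient norm divided by \<open>\<mu>\<close>.
  So the estimate is cut only while it exceeds \<open>2 \<mu>\<close>. This limits the number of cuts by
  \<open>\<lceil>log 4 (\<mu>0 / \<mu>)\<rceil>\<close> and keeps every estimate above \<open>\<mu> / 2\<close>; at \<open>\<mu> / 2\<close> a call costs at most
  \<open>3 + C1 sqrt (10 L / \<mu>)\<close> evaluations (\<open>AR_call\<close>), one less than the price per call in the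
  alternative bound. As at least one call is made, this difference pays for the gradient at the
  starting point. It remains to count the successful calls: each of them halves
  the gradient, and the first one in addition brings it down to at most \<open>\<mu>0 / 4\<close> times the initial
  distance to the minimizer, which gives the two bounds (\<open>SCAR_from_calls\<close>).
\<close>

section \<open>Gradients, smoothness and strong convexity\<close>

lemma GDERIV_unique:
  assumes "GDERIV f x :> D" and "GDERIV f x :> E"
  shows "D = E"
proof -
  have "(\<lambda>h. h \<bullet> D) = (\<lambda>h. h \<bullet> E)"
    using assms unfolding gderiv_def by (rule has_derivative_unique)
  then have "(D - E) \<bullet> (D - E) = 0"
    by (metis inner_diff_right right_minus_eq)
  then show ?thesis by simp
qed

lemma GDERIV_imp_grad: "GDERIV f x :> D \<Longrightarrow> grad f x = D"
  unfolding grad_def by (rule the_equality) (auto intro: GDERIV_unique)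

lemma GDERIV_grad:
  fixes f :: "'a::euclidean_space \<Rightarrow> real"
  assumes "f differentiable (at x)"
  shows "GDERIV f x :> grad f x"
proof -
  obtain f' where f': "(f has_derivative f') (at x)"
    using assms unfolding differentiable_def by blast
  have "h \<bullet> adjoint f' 1 = f' h" for h
    using adjoint_works[OF has_derivative_linear[OF f'], of h 1] by simp
  then have "GDERIV f x :> adjoint f' 1"
    using f' unfolding gderiv_def by (simp add: fun_eq_iff)
  then show ?thesis
    using GDERIV_imp_grad by metis
qed

lemma grad_at_minimizer:
  fixes f :: "'a::euclidean_space \<Rightarrow> real"
  assumes "f differentiable (at p)" and "is_arg_min f (\<lambda>_. True) p"
  shows "grad f p = 0"
proof -
  have "(f has_derivative (\<lambda>h. h \<bullet> grad f p)) (at p)"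
    using GDERIV_grad[OF assms(1)] unfolding gderiv_def .
  then have "(\<lambda>h. h \<bullet> grad f p) = (\<lambda>h. 0)"
    by (rule has_derivative_local_min)
      (use assms(2) in \<open>auto simp: is_arg_min_linorder\<close>)
  then have "grad f p \<bullet> grad f p = 0"
    by meson
  then show ?thesis by simp
qed

lemma has_real_derivative_along_line:
  fixes f :: "'a::euclidean_space \<Rightarrow> real"
  assumes "f differentiable (at (x + t *\<^sub>R d))"
  shows "((\<lambda>s. f (x + s *\<^sub>R d)) has_real_derivative grad f (x + t *\<^sub>R d) \<bullet> d) (at t)"
proof -
  have line: "((\<lambda>s. x + s *\<^sub>R d) has_derivative (\<lambda>s. s *\<^sub>R d)) (at t)"
    by (auto intro!: derivative_eq_intros)
  have "(f has_derivative (\<lambda>h. h \<bullet> grad f (x + t *\<^sub>R d))) (at (x + t *\<^sub>R d))"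
    using GDERIV_grad[OF assms] unfolding gderiv_def .
  from diff_chain_at[OF line this] show ?thesis
    by (simp add: has_field_derivative_def o_def inner_commute mult_commute_abs)
qed

text \<open>
  Along the segment from x to y the function minus its first-order model and minus the quadratic
  term has nonpositive derivative, by Cauchy-Schwarz and the Lipschitz bound.
\<close>

lemma descent_lemma:
  fixes f :: "'a::euclidean_space \<Rightarrow> real"
  assumes "smooth_with L f"
  shows "f y \<le> f x + grad f x \<bullet> (y - x) + L / 2 * (norm (y - x))\<^sup>2"
proof -
  define d where "d = y - x"
  define \<phi> where "\<phi> t = f (x + t *\<^sub>R d) - t * (grad f x \<bullet> d) - L / 2 * t\<^sup>2 * (norm d)\<^sup>2" for t
  have "\<phi> 1 \<le> \<phi> 0"
  proof (rule DERIV_nonpos_imp_nonincreasing[of 0 1 \<phi>])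
    fix t :: real
    assume t: "0 \<le> t" "t \<le> 1"
    let ?D = "grad f (x + t *\<^sub>R d) \<bullet> d - grad f x \<bullet> d - L * t * (norm d)\<^sup>2"
    have "f differentiable (at (x + t *\<^sub>R d))"
      using assms by (simp add: smooth_with_def)
    then have "(\<phi> has_real_derivative ?D) (at t)"
      unfolding \<phi>_def
      by (auto intro!: derivative_eq_intros has_real_derivative_along_line)
    moreover have "?D \<le> 0"
    proof -
      have "(grad f (x + t *\<^sub>R d) - grad f x) \<bullet> d \<le> norm (grad f (x + t *\<^sub>R d) - grad f x) * norm d"
        by (rule norm_cauchy_schwarz)
      also have "\<dots> \<le> L * norm (x + t *\<^sub>R d - x) * norm d"
      proof (rule mult_right_mono)
        show "norm (grad f (x + t *\<^sub>R d) - grad f x) \<le> L * norm (x + t *\<^sub>R d - x)"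
          using assms unfolding smooth_with_def by blast
      qed simp
      finally show ?thesis
        using t by (simp add: inner_diff_left power2_eq_square mult.assoc)
    qed
    ultimately show "\<exists>D. (\<phi> has_real_derivative D) (at t) \<and> D \<le> 0" by blast
  qed simp
  then show ?thesis
    by (simp add: \<phi>_def d_def)
qed

lemma strongly_convex_monotone:
  assumes "strongly_convex_with \<mu> f"
  shows "\<mu> * (norm (x - y))\<^sup>2 \<le> (grad f x - grad f y) \<bullet> (x - y)"
proof -
  have "f x \<ge> f y + grad f y \<bullet> (x - y) + \<mu> / 2 * (norm (x - y))\<^sup>2"
    and "f y \<ge> f x + grad f x \<bullet> (y - x) + \<mu> / 2 * (norm (y - x))\<^sup>2"
    using assms by (auto simp: strongly_convex_with_def)
  then show ?thesis
    by (simp add: inner_diff_left inner_diff_right norm_minus_commute)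
qed

lemma strongly_convex_quadratic_growth:
  fixes f :: "'a::euclidean_space \<Rightarrow> real"
  assumes "strongly_convex_with \<mu> f" and "f differentiable (at p)"
    and "is_arg_min f (\<lambda>_. True) p"
  shows "f p + \<mu> / 2 * (norm (x - p))\<^sup>2 \<le> f x"
proof -
  have "f x \<ge> f p + grad f p \<bullet> (x - p) + \<mu> / 2 * (norm (x - p))\<^sup>2"
    using assms(1) by (simp add: strongly_convex_with_def)
  then show ?thesis
    using grad_at_minimizer[OF assms(2,3)] by simp
qed

section \<open>Quadratic regularization\<close>

lemma norm_diff_sq_shift: "(norm (x - z))\<^sup>2 = (norm (y - z))\<^sup>2 + 2 * ((y - z) \<bullet> (x - y)) + (norm (x - y))\<^sup>2"
  for x y z :: "'a::real_inner"
  by (simp add: power2_norm_eq_inner algebra_simps inner_commute)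

lemma GDERIV_regularized:
  fixes f :: "'a::euclidean_space \<Rightarrow> real"
  assumes "f differentiable (at x)"
  shows "GDERIV (regularized f \<sigma> xb) x :> grad f x + \<sigma> *\<^sub>R (x - xb)"
proof -
  have "(f has_derivative (\<lambda>h. h \<bullet> grad f x)) (at x)"
    using GDERIV_grad[OF assms] unfolding gderiv_def .
  then show ?thesis
    unfolding gderiv_def regularized_def power2_norm_eq_inner
    by (auto intro!: derivative_eq_intros simp: algebra_simps inner_commute)
qed

lemma grad_regularized:
  fixes f :: "'a::euclidean_space \<Rightarrow> real"
  assumes "f differentiable (at x)"
  shows "grad (regularized f \<sigma> xb) x = grad f x + \<sigma> *\<^sub>R (x - xb)"
  using GDERIV_imp_grad[OF GDERIV_regularized[OF assms]] .

lemma differentiable_regularized: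
  fixes f :: "'a::euclidean_space \<Rightarrow> real"
  assumes "f differentiable (at x)"
  shows "regularized f \<sigma> xb differentiable (at x)"
  using GDERIV_regularized[OF assms] unfolding gderiv_def differentiable_def by blast

lemma smooth_regularized:
  fixes f :: "'a::euclidean_space \<Rightarrow> real"
  assumes "smooth_with L f" and "0 \<le> \<sigma>"
  shows "smooth_with (L + \<sigma>) (regularized f \<sigma> xb)"
proof -
  have diff: "f differentiable (at x)" for x
    using assms(1) by (simp add: smooth_with_def)
  have "norm (grad (regularized f \<sigma> xb) x - grad (regularized f \<sigma> xb) y) \<le> (L + \<sigma>) * norm (x - y)"
    for x y
  proof -
    have "grad (regularized f \<sigma> xb) x - grad (regularized f \<sigma> xb) y
        = (grad f x - grad f y) + \<sigma> *\<^sub>R (x - y)"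
      by (simp add: grad_regularized[OF diff] algebra_simps)
    also have "norm \<dots> \<le> L * norm (x - y) + \<sigma> * norm (x - y)"
      using assms by (intro norm_triangle_le add_mono) (auto simp: smooth_with_def)
    finally show ?thesis by (simp add: algebra_simps)
  qed
  then show ?thesis
    using differentiable_regularized[OF diff] by (simp add: smooth_with_def)
qed

lemma strongly_convex_regularized:
  fixes f :: "'a::euclidean_space \<Rightarrow> real"
  assumes "strongly_convex_with \<mu> f" and diff: "\<And>x. f differentiable (at x)"
  shows "strongly_convex_with (\<mu> + \<sigma>) (regularized f \<sigma> xb)"
  unfolding strongly_convex_with_def
proof (intro allI)
  fix x y
  have "f x \<ge> f y + grad f y \<bullet> (x - y) + \<mu> / 2 * (norm (x - y))\<^sup>2"
    using assms(1) by (simp add: strongly_convex_with_def)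
  then show "regularized f \<sigma> xb y + grad (regularized f \<sigma> xb) y \<bullet> (x - y)
      + (\<mu> + \<sigma>) / 2 * (norm (x - y))\<^sup>2 \<le> regularized f \<sigma> xb x"
    unfolding grad_regularized[OF diff] regularized_def norm_diff_sq_shift[of x xb y]
    by (simp add: algebra_simps inner_add_left inner_diff_left add_divide_distrib)
qed

text \<open>
  A lower bound on f makes the regularized function exceed its value at the center outside a
  ball, so its minimum over that ball is global.
\<close>

lemma prox_point_is_arg_min:
  fixes f :: "'a::euclidean_space \<Rightarrow> real"
  assumes cont: "continuous_on UNIV f" and bound: "\<And>x. b \<le> f x" and "0 < \<sigma>"
  shows "is_arg_min (regularized f \<sigma> xb) (\<lambda>_. True) (prox_point f \<sigma> xb)"
proof -
  let ?g = "regularized f \<sigma> xb"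
  \<comment> \<open>Beyond distance r from the center the penalty alone makes up for \<open>f xb - b\<close>.\<close>
  define r where "r = sqrt (2 * (f xb - b) / \<sigma>)"
  have r: "0 \<le> r" "r\<^sup>2 = 2 * (f xb - b) / \<sigma>"
    using bound[of xb] \<open>0 < \<sigma>\<close> by (auto simp: r_def)
  have "continuous_on (cball xb r) ?g"
    unfolding regularized_def
    by (intro continuous_intros continuous_on_subset[OF cont]) auto
  then obtain p where p: "p \<in> cball xb r" "\<And>x. x \<in> cball xb r \<Longrightarrow> ?g p \<le> ?g x"
    using continuous_attains_inf[of "cball xb r" ?g] r(1) by (auto simp: cball_eq_empty)
  have "?g p \<le> ?g x" for x
  proof (cases "x \<in> cball xb r")
    case False
    then have "r\<^sup>2 \<le> (norm (x - xb))\<^sup>2"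
      using r(1) by (intro power_mono) (auto simp: dist_norm norm_minus_commute)
    then have "f xb - b \<le> \<sigma> / 2 * (norm (x - xb))\<^sup>2"
      using r(2) \<open>0 < \<sigma>\<close> by (simp add: field_simps)
    then have "?g xb \<le> ?g x"
      using bound[of x] by (simp add: regularized_def)
    moreover have "?g p \<le> ?g xb"
      using r(1) by (intro p(2)) simp
    ultimately show ?thesis by simp
  qed (use p in blast)
  then have "is_arg_min ?g (\<lambda>_. True) p"
    by (simp add: is_arg_min_linorder)
  then show ?thesis
    unfolding prox_point_def arg_min_def by (rule someI)
qed

lemma weighted_center:
  fixes x' xb' :: "'a::real_vector"
  assumes "\<gamma> = 1 - \<sigma>' / \<sigma>" and "xb = (1 - \<gamma>) *\<^sub>R xb' + \<gamma> *\<^sub>R x'" and "\<sigma> \<noteq> 0"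
  shows "\<sigma> *\<^sub>R xb = \<sigma>' *\<^sub>R xb' + (\<sigma> - \<sigma>') *\<^sub>R x'"
  using assms(3) unfolding assms(2,1) by (simp add: scaleR_add_right right_diff_distrib)

text \<open>
  If the weighted centers agree, the old quadratic plus a quadratic of weight \<open>\<sigma> - \<sigma>'\<close> around
  \<open>x'\<close> is the new quadratic up to a constant; taking differences of values removes the constant.
\<close>

lemma regularized_recentered:
  fixes f :: "'a::euclidean_space \<Rightarrow> real"
  assumes "\<sigma> *\<^sub>R xb = \<sigma>' *\<^sub>R xb' + (\<sigma> - \<sigma>') *\<^sub>R x'"
  shows "regularized f \<sigma> xb x - regularized f \<sigma> xb y
    = regularized f \<sigma>' xb' x - regularized f \<sigma>' xb' y
      + (\<sigma> - \<sigma>') / 2 * ((norm (x - x'))\<^sup>2 - (norm (y - x'))\<^sup>2)"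
proof -
  have weight: "\<sigma> * (z \<bullet> xb) = \<sigma>' * (z \<bullet> xb') + (\<sigma> - \<sigma>') * (z \<bullet> x')" for z
    using arg_cong[OF assms, of "inner z"] by (simp add: inner_add_right)
  have "\<sigma> * (norm (z - xb))\<^sup>2 = \<sigma>' * (norm (z - xb'))\<^sup>2 + (\<sigma> - \<sigma>') * (norm (z - x'))\<^sup>2
      + (\<sigma> * (xb \<bullet> xb) - \<sigma>' * (xb' \<bullet> xb') - (\<sigma> - \<sigma>') * (x' \<bullet> x'))" for z
    unfolding power2_norm_eq_inner using weight[of z]
    by (simp add: inner_diff_left inner_diff_right inner_commute algebra_simps)
  note this[of x] this[of y]
  then show ?thesis
    unfolding regularized_def by (simp add: algebra_simps) (simp add: field_simps)
qed

text \<open>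
  Comparing the two minimizers in both objectives leaves only the added penalty, which must not
  be larger at the new minimizer.
\<close>

lemma minimizer_moves_towards_center:
  fixes f :: "'a::euclidean_space \<Rightarrow> real"
  assumes "\<sigma> *\<^sub>R xb = \<sigma>' *\<^sub>R xb' + (\<sigma> - \<sigma>') *\<^sub>R x'" and "\<sigma>' < \<sigma>"
    and "is_arg_min (regularized f \<sigma>' xb') (\<lambda>_. True) p'"
    and "is_arg_min (regularized f \<sigma> xb) (\<lambda>_. True) p"
  shows "norm (x' - p) \<le> norm (x' - p')"
proof -
  have "regularized f \<sigma>' xb' p' \<le> regularized f \<sigma>' xb' p"
    and "regularized f \<sigma> xb p \<le> regularized f \<sigma> xb p'"
    using assms(3,4) by (auto simp: is_arg_min_linorder)
  then have "(\<sigma> - \<sigma>') / 2 * ((norm (p - x'))\<^sup>2 - (norm (p' - x'))\<^sup>2) \<le> 0"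
    using regularized_recentered[OF assms(1), of f p p'] by linarith
  then have "(norm (p - x'))\<^sup>2 \<le> (norm (p' - x'))\<^sup>2"
    using \<open>\<sigma>' < \<sigma>\<close> by (simp add: mult_le_0_iff)
  then show ?thesis
    by (simp add: norm_minus_commute)
qed

section \<open>Backtracking\<close>

lemma backtracking_test_smooth:
  fixes f :: "'a::euclidean_space \<Rightarrow> real"
  assumes "smooth_with L f" and "0 \<le> \<sigma>" and "L \<le> M"
  shows "backtracking_test (regularized f \<sigma> xb) \<sigma> x M"
proof -
  let ?g = "regularized f \<sigma> xb"
  define x' where "x' = x - (1 / (2 * (M + \<sigma>))) *\<^sub>R grad ?g x"
  have "?g x' \<le> ?g x + grad ?g x \<bullet> (x' - x) + (L + \<sigma>) / 2 * (norm (x' - x))\<^sup>2"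
    using descent_lemma smooth_regularized assms(1,2) by blast
  moreover have "(L + \<sigma>) / 2 * (norm (x' - x))\<^sup>2 \<le> (M + \<sigma>) / 2 * (norm (x' - x))\<^sup>2"
    using assms(3) by (intro mult_right_mono) auto
  ultimately show ?thesis
    unfolding backtracking_test_def Let_def x'_def[symmetric] by linarith
qed

text \<open>
  The step tried by backtracking decreases g by at least \<open>1/2 - 1/8 = 3/8\<close> of the squared gradient
  norm divided by \<open>M + \<sigma>\<close>; no decrease can exceed the gap to a lower bound of g.
\<close>

lemma backtracking_test_grad_bound:
  assumes "backtracking_test g \<sigma> x M" and "0 < M + \<sigma>" and "\<And>y. b \<le> g y"
  shows "(norm (grad g x))\<^sup>2 \<le> 8 / 3 * (M + \<sigma>) * (g x - b)"
proof -
  define s where "s = M + \<sigma>"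
  define A where "A = (norm (grad g x))\<^sup>2"
  let ?y = "x - (1 / (2 * s)) *\<^sub>R grad g x"
  have s: "0 < s" using assms(2) by (simp add: s_def)
  have test: "g ?y - g x - grad g x \<bullet> (?y - x) \<le> s / 2 * (norm (?y - x))\<^sup>2"
    using assms(1) unfolding backtracking_test_def Let_def s_def .
  have "grad g x \<bullet> (?y - x) = - (A / (2 * s))"
    by (simp add: A_def power2_norm_eq_inner)
  moreover have "s / 2 * (norm (?y - x))\<^sup>2 = A / (8 * s)"
    using s by (simp add: A_def power_divide) (simp add: power2_eq_square field_simps)
  ultimately have "g ?y - g x + A / (2 * s) \<le> A / (8 * s)"
    using test by linarith
  moreover have "A / (2 * s) = 4 * (A / (8 * s))"
    by simp
  ultimately have "3 * (A / (8 * s)) \<le> g x - b"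
    using assms(3)[of ?y] by linarith
  then show ?thesis
    using s unfolding A_def s_def by (simp add: field_simps)
qed

lemma backtracking_passes_test: "backtracking g \<sigma> x M M' \<Longrightarrow> backtracking_test g \<sigma> x M'"
  by (induction rule: backtracking.induct) auto

text \<open>
  An estimate is doubled only after a failed test, hence only when it is below L.
\<close>

lemma backtracking_bounds:
  assumes "backtracking g \<sigma> x M M'" and "\<And>M. L \<le> M \<Longrightarrow> backtracking_test g \<sigma> x M"
    and "0 < M" and "M \<le> 2 * L"
  shows "0 < M' \<and> M' \<le> 2 * L"
  using assms
proof (induction rule: backtracking.induct)
  case (backtracking_step M M')
  then have "M < L" by (meson not_le)
  with backtracking_step show ?case by simp
qed simp

lemma backtracking_terminates:
  assumes "\<And>M. L \<le> M \<Longrightarrow> backtracking_test g \<sigma> x M" and "0 < M"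
  shows "\<exists>M'. backtracking g \<sigma> x M M'"
proof -
  have "\<exists>M'. backtracking g \<sigma> x M M'" if "L \<le> 2 ^ n * M" for n M
    using that
  proof (induction n arbitrary: M)
    case 0
    then have "backtracking_test g \<sigma> x M" using assms(1) by simp
    then show ?case by (blast intro: backtracking_stop)
  next
    case (Suc n)
    have "L \<le> 2 ^ n * (2 * M)" using Suc.prems by (simp add: mult_ac)
    from Suc.IH[OF this] show ?case
      by (blast intro: backtracking_stop backtracking_step)
  qed
  moreover obtain n where "L / M < 2 ^ n"
    using real_arch_pow[of 2 "L / M"] by auto
  ultimately show ?thesis
    using assms(2) by (simp add: field_simps) (meson less_imp_le)
qed

section \<open>The subroutine\<close>

lemma subroutine_guaranteeD:
  assumes "subroutine_guarantee \<A> c f L" and "0 < \<sigma>" and "1 \<le> k"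
  shows "snd (\<A> f \<sigma> xb x k) \<le> c * L"
    and "regularized f \<sigma> xb (fst (\<A> f \<sigma> xb x k)) - regularized f \<sigma> xb (prox_point f \<sigma> xb)
      \<le> snd (\<A> f \<sigma> xb x k) / (real k)\<^sup>2 * (norm (x - prox_point f \<sigma> xb))\<^sup>2"
  using assms unfolding subroutine_guarantee_def Let_def case_prod_beta by blast+

text \<open>
  Unless it stops immediately, the subroutine has failed its test one evaluation earlier.
\<close>

lemma subroutine_run_count:
  assumes "subroutine_guarantee \<A> c f L" and "subroutine_run \<A> f \<sigma> xb x z k"
    and "0 < \<sigma>" and "0 \<le> c" and "0 \<le> L"
  shows "real k \<le> 1 + 8 * sqrt (2 * c * L / \<sigma>)"
proof (cases "k = 1")
  case True
  then show ?thesis using assms by simp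
next
  case False
  with assms(2) have k: "k - 1 \<in> {1..<k}"
    by (auto simp: subroutine_run_def)
  with assms(2) have "\<not> subroutine_test \<A> f \<sigma> xb x (k - 1)"
    by (auto simp: subroutine_run_def)
  then have "real (k - 1) < 8 * sqrt (2 * snd (\<A> f \<sigma> xb x (k - 1)) / \<sigma>)"
    by (simp add: subroutine_test_def)
  also have "snd (\<A> f \<sigma> xb x (k - 1)) \<le> c * L"
    by (rule subroutine_guaranteeD(1)[OF assms(1,3)]) (use k in simp)
  then have "8 * sqrt (2 * snd (\<A> f \<sigma> xb x (k - 1)) / \<sigma>) \<le> 8 * sqrt (2 * c * L / \<sigma>)"
    using assms(3) by (intro mult_left_mono real_sqrt_le_mono divide_right_mono) auto
  finally show ?thesis using k by (simp add: of_nat_diff)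
qed

lemma subroutine_terminates:
  assumes "subroutine_guarantee \<A> c f L" and "0 < \<sigma>"
  shows "\<exists>z k. subroutine_run \<A> f \<sigma> xb x z k"
proof -
  let ?P = "\<lambda>k. k \<ge> 1 \<and> subroutine_test \<A> f \<sigma> xb x k"
  obtain n :: nat where n: "8 * sqrt (2 * (c * L) / \<sigma>) \<le> real n"
    using real_arch_simple by blast
  have "snd (\<A> f \<sigma> xb x (Suc n)) \<le> c * L"
    by (rule subroutine_guaranteeD(1)[OF assms]) simp
  then have "8 * sqrt (2 * snd (\<A> f \<sigma> xb x (Suc n)) / \<sigma>) \<le> 8 * sqrt (2 * (c * L) / \<sigma>)"
    using assms(2) by (intro mult_left_mono real_sqrt_le_mono divide_right_mono) auto
  with n have "8 * sqrt (2 * snd (\<A> f \<sigma> xb x (Suc n)) / \<sigma>) \<le> real (Suc n)"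
    by linarith
  then have "?P (Suc n)"
    unfolding subroutine_test_def by simp
  then obtain k where "?P k" and "\<forall>i<k. \<not> ?P i"
    using exists_least_iff[of ?P] by blast
  then have "subroutine_run \<A> f \<sigma> xb x (fst (\<A> f \<sigma> xb x k)) k"
    by (simp add: subroutine_run_def)
  then show ?thesis by blast
qed

text \<open>
  The stopping rule says \<open>128 l / \<sigma> \<le> k\<^sup>2\<close> for the estimate l. A negative l satisfies the
  stopping rule trivially, but then the guarantee is all the stronger.
\<close>

lemma subroutine_run_gap:
  assumes "subroutine_guarantee \<A> c f L" and "subroutine_run \<A> f \<sigma> xb x z k" and "0 < \<sigma>"
  shows "regularized f \<sigma> xb z - regularized f \<sigma> xb (prox_point f \<sigma> xb)
    \<le> \<sigma> / 128 * (norm (x - prox_point f \<sigma> xb))\<^sup>2"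
proof -
  define l where "l = snd (\<A> f \<sigma> xb x k)"
  have k: "k \<ge> 1" "8 * sqrt (2 * l / \<sigma>) \<le> real k" and z: "z = fst (\<A> f \<sigma> xb x k)"
    using assms(2) by (auto simp: subroutine_run_def subroutine_test_def l_def)
  have "l / (real k)\<^sup>2 \<le> \<sigma> / 128"
  proof (cases "l \<le> 0")
    case True
    then have "l / (real k)\<^sup>2 \<le> 0"
      by (simp add: divide_nonpos_nonneg)
    also have "0 \<le> \<sigma> / 128" using assms(3) by simp
    finally show ?thesis .
  next
    case False
    then have "(8 * sqrt (2 * l / \<sigma>))\<^sup>2 \<le> (real k)\<^sup>2"
      using k assms(3) by (intro power_mono) auto
    then have "128 * l / \<sigma> \<le> (real k)\<^sup>2"
      using False assms(3) by (simp add: power_mult_distrib)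
    then show ?thesis
      using k(1) assms(3) by (simp add: field_simps)
  qed
  then have "l / (real k)\<^sup>2 * (norm (x - prox_point f \<sigma> xb))\<^sup>2
      \<le> \<sigma> / 128 * (norm (x - prox_point f \<sigma> xb))\<^sup>2"
    by (rule mult_right_mono) simp
  moreover have "regularized f \<sigma> xb z - regularized f \<sigma> xb (prox_point f \<sigma> xb)
      \<le> l / (real k)\<^sup>2 * (norm (x - prox_point f \<sigma> xb))\<^sup>2"
    unfolding z l_def by (rule subroutine_guaranteeD(2)[OF assms(1,3) k(1)])
  ultimately show ?thesis by linarith
qed

section \<open>Accumulative regularization\<close>

locale strongly_convex_subroutine =
  fixes f :: "'a::euclidean_space \<Rightarrow> real" and L \<mu> :: real and xstar :: 'a
    and \<A> :: "'a subroutine" and c :: real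
  assumes smooth: "smooth_with L f"
    and mu_pos: "\<mu> > 0" and strongly_convex: "strongly_convex_with \<mu> f"
    and xstar: "is_arg_min f (\<lambda>_. True) xstar"
    and c_nonneg: "c \<ge> 0" and guarantee: "subroutine_guarantee \<A> c f L"
begin

lemma f_differentiable: "f differentiable (at x)"
  using smooth by (simp add: smooth_with_def)

lemma prox_point_minimizes: "0 < \<sigma> \<Longrightarrow> is_arg_min (regularized f \<sigma> xb) (\<lambda>_. True) (prox_point f \<sigma> xb)"
proof (rule prox_point_is_arg_min)
  show "continuous_on UNIV f"
    using f_differentiable by (simp add: continuous_on_eq_continuous_at differentiable_imp_continuous_within)
  show "f xstar \<le> f x" for x
    using xstar by (simp add: is_arg_min_linorder)
qed

lemma grad_norm_ge: "\<mu> * norm (y - xstar) \<le> norm (grad f y)"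
proof -
  have "\<mu> * (norm (y - xstar))\<^sup>2 \<le> (grad f y - grad f xstar) \<bullet> (y - xstar)"
    using strongly_convex by (rule strongly_convex_monotone)
  also have "\<dots> = grad f y \<bullet> (y - xstar)"
    using grad_at_minimizer[OF f_differentiable xstar] by simp
  also have "\<dots> \<le> norm (grad f y) * norm (y - xstar)"
    by (rule norm_cauchy_schwarz)
  finally show ?thesis
    by (cases "y = xstar") (auto simp: power2_eq_square)
qed

lemma mu_le_L: "\<mu> \<le> L"
proof -
  obtain b :: 'a where "b \<in> Basis" using nonempty_Basis by blast
  then have "norm b = 1" by simp
  have "\<mu> * (norm (b - 0))\<^sup>2 \<le> (grad f b - grad f 0) \<bullet> (b - 0)"
    using strongly_convex by (rule strongly_convex_monotone)
  also have "\<dots> \<le> norm (grad f b - grad f 0) * norm (b - 0)"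
    by (rule norm_cauchy_schwarz)
  also have "\<dots> \<le> L * norm (b - 0) * norm (b - 0)"
    using smooth unfolding smooth_with_def by (intro mult_right_mono) (blast, simp)
  finally show ?thesis using \<open>norm b = 1\<close> by simp
qed

lemma L_pos: "0 < L"
  using mu_pos mu_le_L by linarith

lemma backtracking_test_passes: "0 < \<sigma> \<Longrightarrow> L \<le> M \<Longrightarrow> backtracking_test (regularized f \<sigma> xb) \<sigma> x M"
  using backtracking_test_smooth[OF smooth] by simp

text \<open>
  The gap in function value, at most \<open>\<sigma> / 128\<close> times the squared old distance, dominates
  \<open>\<sigma> / 2\<close> times the squared new distance by strong convexity of the subproblem.
\<close>

lemma subroutine_contraction:
  assumes "subroutine_run \<A> f \<sigma> xb x' x k" and "0 < \<sigma>"
  defines "p \<equiv> prox_point f \<sigma> xb"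
  shows "norm (x - p) \<le> norm (x' - p) / 8"
proof -
  let ?g = "regularized f \<sigma> xb"
  have "?g p + (\<mu> + \<sigma>) / 2 * (norm (x - p))\<^sup>2 \<le> ?g x"
    unfolding p_def
    by (rule strongly_convex_quadratic_growth)
      (use strongly_convex_regularized[OF strongly_convex f_differentiable] differentiable_regularized[OF f_differentiable]
        prox_point_minimizes[OF assms(2)] in auto)
  moreover have "\<sigma> / 2 * (norm (x - p))\<^sup>2 \<le> (\<mu> + \<sigma>) / 2 * (norm (x - p))\<^sup>2"
    using mu_pos by (intro mult_right_mono) auto
  moreover have "?g x - ?g p \<le> \<sigma> / 128 * (norm (x' - p))\<^sup>2"
    unfolding p_def using subroutine_run_gap[OF guarantee assms(1,2)] .
  ultimately have "\<sigma> / 2 * (norm (x - p))\<^sup>2 \<le> \<sigma> / 128 * (norm (x' - p))\<^sup>2"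
    by linarith
  also have "\<dots> = \<sigma> / 2 * (norm (x' - p) / 8)\<^sup>2"
    by (simp add: power_divide)
  finally have "(norm (x - p))\<^sup>2 \<le> (norm (x' - p) / 8)\<^sup>2"
    using assms(2) by simp
  then show ?thesis
    by (rule power2_le_imp_le) simp
qed

text \<open>
  With \<open>M \<le> \<sigma>\<close> the gradient bound of backtracking combines with the gap \<open>\<sigma> / 128\<close> into the
  factor \<open>8/3 * 2 \<sigma> * \<sigma> / 128 = \<sigma>\<^sup>2 / 24\<close>, and \<open>1/24 \<le> 1/16\<close>.
\<close>

lemma grad_regularized_at_stop:
  assumes "subroutine_run \<A> f \<sigma> xb x' x k" and "0 < \<sigma>"
    and "backtracking_test (regularized f \<sigma> xb) \<sigma> x M" and "0 < M" and "M \<le> \<sigma>"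
  shows "norm (grad (regularized f \<sigma> xb) x) \<le> \<sigma> / 4 * norm (x' - prox_point f \<sigma> xb)"
proof -
  let ?g = "regularized f \<sigma> xb" and ?p = "prox_point f \<sigma> xb"
  have gap: "?g x - ?g ?p \<le> \<sigma> / 128 * (norm (x' - ?p))\<^sup>2"
    by (rule subroutine_run_gap[OF guarantee assms(1,2)])
  have "(norm (grad ?g x))\<^sup>2 \<le> 8 / 3 * (M + \<sigma>) * (?g x - ?g ?p)"
    by (rule backtracking_test_grad_bound)
      (use assms prox_point_minimizes[OF assms(2)] in \<open>auto simp: is_arg_min_linorder\<close>)
  also have "\<dots> \<le> 8 / 3 * (2 * \<sigma>) * (\<sigma> / 128 * (norm (x' - ?p))\<^sup>2)"
    using assms gap prox_point_minimizes[OF assms(2)] by (intro mult_mono) (auto simp: is_arg_min_linorder)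
  also have "\<dots> = 2 / 3 * (\<sigma> / 4 * norm (x' - ?p))\<^sup>2"
    by (simp add: power2_eq_square)
  also have "\<dots> \<le> (\<sigma> / 4 * norm (x' - ?p))\<^sup>2"
    by simp
  finally show ?thesis
    by (rule power2_le_imp_le) (use assms(2) in simp)
qed

text \<open>
  The first call of AR has \<open>\<sigma>' = 0\<close>, where any minimizer of f is a minimizer \<open>p'\<close> of the previous
  objective; this makes the first iteration an instance of the general one. The last claim
  follows since \<open>\<sigma> (x - xb)\<close> differs from \<open>\<sigma>' (x' - xb')\<close> by \<open>\<sigma> (x - x')\<close>.
\<close>

lemma AR_iteration:
  assumes "\<gamma> = 1 - \<sigma>' / \<sigma>" and "xb = (1 - \<gamma>) *\<^sub>R xb' + \<gamma> *\<^sub>R x'"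
    and "subroutine_run \<A> f \<sigma> xb x' x k"
    and "0 \<le> \<sigma>'" and "\<sigma>' < \<sigma>" and "is_arg_min (regularized f \<sigma>' xb') (\<lambda>_. True) p'"
  shows "norm (x' - prox_point f \<sigma> xb) \<le> norm (x' - p')"
    and "norm (x - prox_point f \<sigma> xb) \<le> norm (x' - p') / 8"
    and "norm (\<sigma> *\<^sub>R (x - xb)) \<le> norm (\<sigma>' *\<^sub>R (x' - xb')) + 9 / 8 * \<sigma> * norm (x' - p')"
proof -
  let ?p = "prox_point f \<sigma> xb"
  have \<sigma>: "0 < \<sigma>" using assms by simp
  have center: "\<sigma> *\<^sub>R xb = \<sigma>' *\<^sub>R xb' + (\<sigma> - \<sigma>') *\<^sub>R x'"
    using weighted_center[OF assms(1,2)] \<sigma> by simp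
  show near: "norm (x' - ?p) \<le> norm (x' - p')"
    by (rule minimizer_moves_towards_center[OF center assms(5,6) prox_point_minimizes[OF \<sigma>]])
  show contr: "norm (x - ?p) \<le> norm (x' - p') / 8"
    using subroutine_contraction[OF assms(3) \<sigma>] near by linarith
  have "norm (x - x') \<le> norm (x - ?p) + norm (x' - ?p)"
    using norm_triangle_ineq4[of "x - ?p" "x' - ?p"] by simp
  then have step: "norm (x - x') \<le> 9 / 8 * norm (x' - p')"
    using near contr by linarith
  have "\<sigma> *\<^sub>R (x - xb) = \<sigma>' *\<^sub>R (x' - xb') + \<sigma> *\<^sub>R (x - x')"
    using center by (simp add: algebra_simps)
  also have "norm \<dots> \<le> norm (\<sigma>' *\<^sub>R (x' - xb')) + \<sigma> * norm (x - x')"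
    using norm_triangle_ineq[of "\<sigma>' *\<^sub>R (x' - xb')" "\<sigma> *\<^sub>R (x - x')"] \<sigma> by simp
  also have "\<sigma> * norm (x - x') \<le> \<sigma> * (9 / 8 * norm (x' - p'))"
    using step \<sigma> by (intro mult_left_mono) auto
  finally show "norm (\<sigma> *\<^sub>R (x - xb)) \<le> norm (\<sigma>' *\<^sub>R (x' - xb')) + 9 / 8 * \<sigma> * norm (x' - p')"
    by (simp add: mult_ac)
qed

text \<open>
  The constant 5/2 is inductive: a further iteration multiplies \<open>\<sigma>\<close> by 4 and the distance by at
  most 1/8, so that \<open>9/8 + 5/2 * 4/8 \<le> 5/2\<close>, while the stopping iteration needs
  \<open>9/8 + 1/4 \<le> 5/2\<close>.
\<close>

lemma AR_from_grad_bound: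
  assumes "AR_from \<A> f \<sigma>' \<sigma> xb' x' M' xh Mh N"
    and "0 \<le> \<sigma>'" and "\<sigma>' < \<sigma>" and "is_arg_min (regularized f \<sigma>' xb') (\<lambda>_. True) p'"
    and "0 < M'" and "M' \<le> 4 * L"
  shows "norm (grad f xh) \<le> norm (\<sigma>' *\<^sub>R (x' - xb')) + 5 / 2 * \<sigma> * norm (x' - p')
    \<and> 0 < Mh \<and> Mh \<le> 4 * L"
  using assms
proof (induction arbitrary: p' rule: AR_from.induct)
  case (AR_stop \<gamma> \<sigma>' \<sigma> xb xb' x' x k M' M)
  have \<sigma>: "0 < \<sigma>" using AR_stop by simp
  have M: "0 < M \<and> M \<le> 2 * L"
    by (rule backtracking_bounds[OF AR_stop(4) backtracking_test_passes[OF \<sigma>]])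
      (use AR_stop in auto)
  note iter = AR_iteration[OF AR_stop(1-3) AR_stop(6-8)]
  have "norm (grad (regularized f \<sigma> xb) x) \<le> \<sigma> / 4 * norm (x' - prox_point f \<sigma> xb)"
    by (rule grad_regularized_at_stop[OF AR_stop(3) \<sigma> backtracking_passes_test[OF AR_stop(4)]])
      (use M AR_stop in auto)
  also have "\<dots> \<le> \<sigma> / 4 * norm (x' - p')"
    using iter(1) \<sigma> by (intro mult_left_mono) auto
  finally have "norm (grad (regularized f \<sigma> xb) x) \<le> \<sigma> / 4 * norm (x' - p')" .
  moreover have "norm (grad f x) \<le> norm (grad (regularized f \<sigma> xb) x) + norm (\<sigma> *\<^sub>R (x - xb))"
    using norm_triangle_ineq4[of "grad (regularized f \<sigma> xb) x" "\<sigma> *\<^sub>R (x - xb)"]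
    by (simp add: grad_regularized[OF f_differentiable])
  moreover have "0 \<le> \<sigma> * norm (x' - p')" using \<sigma> by simp
  ultimately show ?case using iter(3) M L_pos by auto
next
  case (AR_step \<gamma> \<sigma>' \<sigma> xb xb' x' x k M' M xh Mh N)
  let ?p = "prox_point f \<sigma> xb"
  have \<sigma>: "0 < \<sigma>" using AR_step by simp
  have M: "0 < M \<and> M \<le> 2 * L"
    by (rule backtracking_bounds[OF AR_step(4) backtracking_test_passes[OF \<sigma>]])
      (use AR_step in auto)
  note iter = AR_iteration[OF AR_step(1-3) AR_step.prems(1-3)]
  have IH: "norm (grad f xh) \<le> norm (\<sigma> *\<^sub>R (x - xb)) + 5 / 2 * (4 * \<sigma>) * norm (x - ?p)
      \<and> 0 < Mh \<and> Mh \<le> 4 * L"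
    by (rule AR_step.IH) (use \<sigma> prox_point_minimizes[OF \<sigma>] M L_pos in auto)
  have "5 / 2 * (4 * \<sigma>) * norm (x - ?p) \<le> 5 / 2 * (4 * \<sigma>) * (norm (x' - p') / 8)"
    using iter(2) \<sigma> by (intro mult_left_mono) auto
  moreover have "0 \<le> \<sigma> * norm (x' - p')" using \<sigma> by simp
  ultimately show ?case using IH iter(3) by auto
qed

lemma subroutine_run_sqrt_count:
  assumes "subroutine_run \<A> f \<sigma> xb x z k" and "0 < \<sigma>"
  shows "real k \<le> 1 + 8 * (sqrt c * sqrt (2 * L / \<sigma>))"
proof -
  have "real k \<le> 1 + 8 * sqrt (2 * c * L / \<sigma>)"
    using subroutine_run_count[OF guarantee assms] c_nonneg L_pos by simp
  also have "2 * c * L / \<sigma> = c * (2 * L / \<sigma>)"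
    by simp
  finally show ?thesis
    by (simp only: real_sqrt_mult)
qed

text \<open>
  For \<open>a \<le> 1\<close> the current iteration is the last one, since \<open>\<sigma> \<ge> 2 L \<ge> M\<close>. For \<open>a > 1\<close> the two
  evaluations of one iteration that do not scale with \<open>a\<close> are paid for by the halving of
  \<open>2 a\<close>; this pays fully only if \<open>a \<ge> 2\<close>, and otherwise the next iteration is the last one. The
  case distinction in the bound makes this an induction.
\<close>

lemma AR_from_cost:
  assumes "AR_from \<A> f \<sigma>' \<sigma> xb' x' M' xh Mh N"
    and "0 < \<sigma>" and "0 < M'" and "M' \<le> 4 * L"
  defines "a \<equiv> sqrt (2 * L / \<sigma>)"
  shows "real N \<le> (if a \<le> 1 then 2 else 3 + 2 * a) + 16 * sqrt c * a"
  using assms(1-4) unfolding a_def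
proof (induction rule: AR_from.induct)
  case (AR_stop \<gamma> \<sigma>' \<sigma> xb xb' x' x k M' M)
  define a where "a = sqrt (2 * L / \<sigma>)"
  have "0 \<le> a" using L_pos AR_stop by (simp add: a_def)
  then have "0 \<le> sqrt c * a" using c_nonneg by simp
  have "real k \<le> 1 + 8 * (sqrt c * a)"
    using subroutine_run_sqrt_count[OF AR_stop(3)] AR_stop by (simp add: a_def)
  then have "real (k + 1) \<le> 2 + 16 * (sqrt c * a)"
    using \<open>0 \<le> sqrt c * a\<close> by simp
  also have "\<dots> \<le> (if a \<le> 1 then 2 else 3 + 2 * a) + 16 * (sqrt c * a)"
    using \<open>0 \<le> a\<close> by simp
  finally show ?case unfolding a_def by (simp only: mult.assoc)
next
  case (AR_step \<gamma> \<sigma>' \<sigma> xb xb' x' x k M' M xh Mh N)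
  define a where "a = sqrt (2 * L / \<sigma>)"
  define b where "b = sqrt c * a"
  have M: "0 < M \<and> M \<le> 2 * L"
    by (rule backtracking_bounds[OF AR_step(4) backtracking_test_passes[OF \<open>0 < \<sigma>\<close>]])
      (use AR_step in auto)
  have k: "real k \<le> 1 + 8 * b"
    using subroutine_run_sqrt_count[OF AR_step(3)] AR_step by (simp add: a_def b_def)
  have "sqrt (2 * L / (4 * \<sigma>)) = sqrt (2 * L / \<sigma> / 4)"
    by simp
  also have "\<dots> = a / 2"
    unfolding a_def by (simp only: real_sqrt_divide real_sqrt_four)
  finally have half: "sqrt (2 * L / (4 * \<sigma>)) = a / 2" .
  have "1 < a"
    using AR_step.hyps(5) AR_step.prems(1) M by (simp add: a_def field_simps)
  have "real N \<le> (if a / 2 \<le> 1 then 2 else 3 + 2 * (a / 2)) + 16 * sqrt c * (a / 2)"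
    using AR_step.IH AR_step.prems M L_pos unfolding half by simp
  also have "16 * sqrt c * (a / 2) = 8 * b"
    by (simp add: b_def)
  also have "(if a / 2 \<le> 1 then 2 else 3 + 2 * (a / 2)) \<le> 1 + 2 * a"
    using \<open>1 < a\<close> by simp
  finally have "real N \<le> 1 + 2 * a + 8 * b" by simp
  with k have "real (k + 1 + N) \<le> 3 + 2 * a + 16 * b"
    by simp
  moreover have "\<not> a \<le> 1" using \<open>1 < a\<close> by simp
  ultimately show ?case
    unfolding a_def b_def by (simp only: mult.assoc if_False)
qed

text \<open>
  Induction on the number of quadruplings after which \<open>\<sigma>\<close> reaches \<open>2 L\<close>.
\<close>

lemma AR_from_terminates:
  assumes "0 < \<sigma>" and "0 < M'" and "M' \<le> 4 * L"
  shows "\<exists>xh Mh N. AR_from \<A> f \<sigma>' \<sigma> xb' x' M' xh Mh N"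
proof -
  have "\<exists>xh Mh N. AR_from \<A> f \<sigma>' \<sigma> xb' x' M' xh Mh N"
    if "2 * L \<le> 4 ^ n * \<sigma>" "0 < \<sigma>" "0 < M'" "M' \<le> 4 * L" for n \<sigma>' \<sigma> xb' x' M'
    using that
  proof (induction n arbitrary: \<sigma>' \<sigma> xb' x' M')
    case (0 \<sigma>' \<sigma> xb' x' M')
    define xb where "xb = (1 - (1 - \<sigma>' / \<sigma>)) *\<^sub>R xb' + (1 - \<sigma>' / \<sigma>) *\<^sub>R x'"
    obtain x k where run: "subroutine_run \<A> f \<sigma> xb x' x k"
      using subroutine_terminates[OF guarantee \<open>0 < \<sigma>\<close>] by blast
    obtain M where M: "backtracking (regularized f \<sigma> xb) \<sigma> x (M' / 2) M"
      using backtracking_terminates[OF backtracking_test_passes[OF \<open>0 < \<sigma>\<close>]] \<open>0 < M'\<close>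
      by (metis half_gt_zero)
    have "0 < M \<and> M \<le> 2 * L"
      by (rule backtracking_bounds[OF M backtracking_test_passes[OF \<open>0 < \<sigma>\<close>]]) (use 0 in auto)
    then have "M \<le> \<sigma>" using 0 by simp
    then show ?case using AR_stop[OF refl xb_def run M] by blast
  next
    case (Suc n \<sigma>' \<sigma> xb' x' M')
    define xb where "xb = (1 - (1 - \<sigma>' / \<sigma>)) *\<^sub>R xb' + (1 - \<sigma>' / \<sigma>) *\<^sub>R x'"
    obtain x k where run: "subroutine_run \<A> f \<sigma> xb x' x k"
      using subroutine_terminates[OF guarantee \<open>0 < \<sigma>\<close>] by blast
    obtain M where M: "backtracking (regularized f \<sigma> xb) \<sigma> x (M' / 2) M"
      using backtracking_terminates[OF backtracking_test_passes[OF \<open>0 < \<sigma>\<close>]] \<open>0 < M'\<close>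
      by (metis half_gt_zero)
    have "0 < M \<and> M \<le> 2 * L"
      by (rule backtracking_bounds[OF M backtracking_test_passes[OF \<open>0 < \<sigma>\<close>]]) (use Suc in auto)
    then obtain xh Mh N where "AR_from \<A> f \<sigma> (4 * \<sigma>) xb x M xh Mh N"
      using Suc.IH[of "4 * \<sigma>" M \<sigma> xb x] Suc.prems L_pos by auto
    then show ?case
      using AR_stop[OF refl xb_def run M] AR_step[OF refl xb_def run M] by blast
  qed
  moreover obtain n where "2 * L / \<sigma> < 4 ^ n"
    using real_arch_pow[of 4 "2 * L / \<sigma>"] by auto
  then have "2 * L \<le> 4 ^ n * \<sigma>" using assms(1) by (simp add: field_simps)
  ultimately show ?thesis using assms by blast
qed

section \<open>The outer loop\<close>

definition call_cost :: real where
  "call_cost = 4 + C1 c * sqrt (10 * L / \<mu>)"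

text \<open>
  The cost bound holds down to \<open>m = \<mu> / 2\<close> because the factor \<open>sqrt 2\<close> in \<open>C1\<close> absorbs the
  corresponding loss in \<open>sqrt (L / m)\<close>.
\<close>

lemma AR_call:
  assumes "AR \<A> f y (m / 10) M z M' k" and "\<mu> / 2 \<le> m" and "0 < M" and "M \<le> 4 * L"
  shows "norm (grad f z) \<le> m / 4 * norm (y - xstar)"
    and "0 < M'" and "M' \<le> 4 * L" and "real k \<le> call_cost - 1"
proof -
  have m: "0 < m" using assms(2) mu_pos by linarith
  have run: "AR_from \<A> f 0 (m / 10) y y M z M' k"
    using assms(1) by (simp add: AR_def)
  have "is_arg_min (regularized f 0 y) (\<lambda>_. True) xstar"
    using xstar by (simp add: is_arg_min_linorder regularized_def)
  from AR_from_grad_bound[OF run _ _ this] m assms(3,4)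
  show "norm (grad f z) \<le> m / 4 * norm (y - xstar)" "0 < M'" "M' \<le> 4 * L"
    by auto
  define a where "a = sqrt (2 * L / (m / 10))"
  define b where "b = sqrt (10 * L / \<mu>)"
  have b: "0 \<le> b" using L_pos mu_pos by (simp add: b_def)
  have "2 * L / (m / 10) \<le> 4 * (10 * L / \<mu>)"
  proof -
    have "2 * L / (m / 10) \<le> 2 * L / (\<mu> / 2 / 10)"
      using assms(2) L_pos mu_pos m by (intro divide_left_mono) auto
    then show ?thesis by simp
  qed
  then have "a \<le> sqrt (4 * (10 * L / \<mu>))"
    unfolding a_def by (rule real_sqrt_le_mono)
  also have "\<dots> = 2 * b"
    unfolding b_def by (simp only: real_sqrt_mult real_sqrt_four)
  finally have ab: "a \<le> 2 * b" .
  have "0 \<le> a" using L_pos m by (simp add: a_def)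
  have "real k \<le> (if a \<le> 1 then 2 else 3 + 2 * a) + 16 * sqrt c * a"
    unfolding a_def by (rule AR_from_cost[OF run]) (use m assms in auto)
  also have "\<dots> \<le> 3 + 2 * a + 16 * sqrt c * a"
    using \<open>0 \<le> a\<close> by simp
  also have "\<dots> \<le> 3 + 4 * b + 16 * sqrt c * (2 * b)"
    using ab c_nonneg by (intro add_mono mult_left_mono) auto
  also have "\<dots> \<le> 3 + 3 * sqrt 2 * b + 16 * sqrt c * (2 * b)"
  proof -
    \<comment> \<open>The two evaluations per iteration contribute \<open>2 a \<le> 4 b\<close>, for which C1 provides \<open>3 sqrt 2 b\<close>.\<close>
    have "(4 / 3)\<^sup>2 \<le> (2 :: real)" by (simp add: power2_eq_square)
    then have "4 / 3 \<le> sqrt (2 :: real)" by (rule real_le_rsqrt)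
    then show ?thesis using mult_right_mono[of 4 "3 * sqrt 2" b] b by simp
  qed
  also have "\<dots> = call_cost - 1"
    by (simp add: call_cost_def C1_def b_def real_sqrt_mult algebra_simps)
  finally show "real k \<le> call_cost - 1" .
qed

lemma AR_success:
  assumes "AR \<A> f y (m / 10) M z M' k" and "\<mu> / 2 \<le> m" and "0 < M" and "M \<le> 4 * L"
    and "m \<le> 2 * \<mu>"
  shows "norm (grad f z) \<le> norm (grad f y) / 2"
proof -
  have "norm (grad f z) \<le> m / 4 * norm (y - xstar)"
    by (rule AR_call(1)[OF assms(1-4)])
  also have "\<dots> \<le> 2 * \<mu> / 4 * norm (y - xstar)"
    using assms(5) by (intro mult_right_mono) auto
  also have "\<dots> \<le> norm (grad f y) / 2"
    using grad_norm_ge[of y] by simp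
  finally show ?thesis .
qed

text \<open>
  Induction on the number of remaining cuts of the estimate m, which happen only above \<open>2 \<mu>\<close>,
  plus the number of remaining halvings of the gradient.
\<close>

lemma SCAR_from_terminates:
  assumes "0 < \<epsilon>" and "\<mu> / 2 \<le> m" and "0 < M" and "M \<le> 4 * L" and "\<epsilon> < norm (grad f y)"
  shows "\<exists>xh Mh N. SCAR_from \<A> f \<epsilon> y m M xh Mh N"
proof -
  have "\<exists>xh Mh N. SCAR_from \<A> f \<epsilon> y m M xh Mh N"
    if "m \<le> 2 * \<mu> * 4 ^ i" "norm (grad f y) \<le> \<epsilon> * 2 ^ j"
      "\<mu> / 2 \<le> m" "0 < M" "M \<le> 4 * L" "\<epsilon> < norm (grad f y)" for i j y m M
    using that
  proof (induction "i + j" arbitrary: i j y m M rule: less_induct)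
    case less
    note prems = less.prems
    have m: "0 < m" using prems(3) mu_pos by linarith
    obtain z M' k where AR: "AR \<A> f y (m / 10) M z M' k"
      using AR_from_terminates[of "m / 10" M 0 y y] prems m unfolding AR_def by auto
    note call = AR_call[OF AR prems(3-5)]
    show ?case
    proof (cases "norm (grad f z) > norm (grad f y) / 2")
      case True
      then have "2 * \<mu> < m"
        using AR_success[OF AR prems(3-5)] by linarith
      with prems(1) obtain i' where i: "i = Suc i'"
        by (cases i) auto
      have "\<exists>xh Mh N. SCAR_from \<A> f \<epsilon> y (m / 4) M' xh Mh N"
        by (rule less.hyps[of i' j]) (use i prems call \<open>2 * \<mu> < m\<close> in auto)
      then show ?thesis
        using SCAR_step[OF AR, of y "m / 4" \<epsilon>] True prems(6) by fastforce
    next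
      case False
      show ?thesis
      proof (cases "norm (grad f z) \<le> \<epsilon>")
        case True
        then show ?thesis
          using SCAR_stop[OF AR, of z m \<epsilon>] False by auto
      next
        case unfinished: False
        from prems(2,6) obtain j' where j: "j = Suc j'"
          by (cases j) auto
        have "\<exists>xh Mh N. SCAR_from \<A> f \<epsilon> z m M' xh Mh N"
          by (rule less.hyps[of i j']) (use j prems call False unfinished in auto)
        then show ?thesis
          using SCAR_step[OF AR, of z m \<epsilon>] False unfinished by fastforce
      qed
    qed
  qed
  moreover obtain i where "m / (2 * \<mu>) < 4 ^ i"
    using real_arch_pow[of 4 "m / (2 * \<mu>)"] by auto
  then have "m \<le> 2 * \<mu> * 4 ^ i" using mu_pos by (simp add: field_simps)
  moreover obtain j where "norm (grad f y) / \<epsilon> < 2 ^ j"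
    using real_arch_pow[of 2 "norm (grad f y) / \<epsilon>"] by auto
  then have "norm (grad f y) \<le> \<epsilon> * 2 ^ j" using \<open>0 < \<epsilon>\<close> by (simp add: field_simps)
  ultimately show ?thesis using assms by blast
qed

text \<open>
  F counts the rejected calls and S the successful ones before the last call, which is always
  successful since a rejected call restores a point whose gradient exceeds \<open>\<epsilon>\<close>. The gradient
  is halved by each success and still exceeds \<open>\<epsilon>\<close> before the last one. If there are at least two,
  the first success yields a gradient norm of at most \<open>m / 4\<close> times the distance from y to the
  minimizer, after which \<open>S - 1\<close> further halvings still exceed \<open>\<epsilon>\<close>.
\<close>

lemma SCAR_from_calls:
  assumes "SCAR_from \<A> f \<epsilon> y m M xh Mh N"
    and "\<mu> / 2 \<le> m" and "0 < M" and "M \<le> 4 * L" and "\<epsilon> < norm (grad f y)"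
  shows "norm (grad f xh) \<le> \<epsilon> \<and>
    (\<exists>F S. real N \<le> real (F + Suc S) * (call_cost - 1)
      \<and> (F = 0 \<or> 2 * \<mu> * 4 ^ (F - 1) < m)
      \<and> \<epsilon> * 2 ^ S < norm (grad f y)
      \<and> (S = 0 \<or> \<epsilon> * 2 ^ (S - 1) < m / 4 * norm (y - xstar)))"
  using assms
proof (induction rule: SCAR_from.induct)
  case (SCAR_stop y m M z M' k y' m')
  note call = AR_call[OF SCAR_stop(1,4-6)]
  have "y' = z"
    using SCAR_stop by (auto split: if_splits)
  moreover have "real k \<le> real (0 + Suc 0) * (call_cost - 1)"
    using call by simp
  moreover have "\<epsilon> * 2 ^ 0 < norm (grad f y)"
    using SCAR_stop by simp
  ultimately show ?case using SCAR_stop(3) by blast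
next
  case (SCAR_step y m M z M' k y' m' xh Mh N)
  note call = AR_call[OF SCAR_step(1) SCAR_step.prems(1-3)]
  show ?case
  proof (cases "norm (grad f z) > norm (grad f y) / 2")
    case True
    then have eq: "y' = y" "m' = m / 4"
      using SCAR_step(2) by auto
    have large: "2 * \<mu> < m"
      using True AR_success[OF SCAR_step(1) SCAR_step.prems(1-3)] by linarith
    have IH: "norm (grad f xh) \<le> \<epsilon> \<and>
      (\<exists>F S. real N \<le> real (F + Suc S) * (call_cost - 1)
        \<and> (F = 0 \<or> 2 * \<mu> * 4 ^ (F - 1) < m')
        \<and> \<epsilon> * 2 ^ S < norm (grad f y')
        \<and> (S = 0 \<or> \<epsilon> * 2 ^ (S - 1) < m' / 4 * norm (y' - xstar)))"
      by (rule SCAR_step.IH) (use eq large call SCAR_step.prems in auto)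
    then obtain F S where FS: "real N \<le> real (F + Suc S) * (call_cost - 1)"
      "F = 0 \<or> 2 * \<mu> * 4 ^ (F - 1) < m / 4" "\<epsilon> * 2 ^ S < norm (grad f y)"
      "S = 0 \<or> \<epsilon> * 2 ^ (S - 1) < m / 4 / 4 * norm (y - xstar)"
      unfolding eq by blast
    have "real (k + N) \<le> real (Suc F + Suc S) * (call_cost - 1)"
      using FS(1) call(4) by (simp add: algebra_simps)
    moreover have "2 * \<mu> * 4 ^ (Suc F - 1) < m"
      using FS(2) large by (cases F) auto
    moreover have "m / 4 / 4 * norm (y - xstar) \<le> m / 4 * norm (y - xstar)"
      using large mu_pos by (intro mult_right_mono) auto
    then have "S = 0 \<or> \<epsilon> * 2 ^ (S - 1) < m / 4 * norm (y - xstar)"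
      using FS(4) by linarith
    ultimately show ?thesis using IH FS(3) by blast
  next
    case False
    then have eq: "y' = z" "m' = m"
      using SCAR_step(2) by auto
    have IH: "norm (grad f xh) \<le> \<epsilon> \<and>
      (\<exists>F S. real N \<le> real (F + Suc S) * (call_cost - 1)
        \<and> (F = 0 \<or> 2 * \<mu> * 4 ^ (F - 1) < m')
        \<and> \<epsilon> * 2 ^ S < norm (grad f y')
        \<and> (S = 0 \<or> \<epsilon> * 2 ^ (S - 1) < m' / 4 * norm (y' - xstar)))"
      by (rule SCAR_step.IH) (use eq call SCAR_step in auto)
    then obtain F S where FS: "real N \<le> real (F + Suc S) * (call_cost - 1)"
      "F = 0 \<or> 2 * \<mu> * 4 ^ (F - 1) < m" "\<epsilon> * 2 ^ S < norm (grad f z)"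
      unfolding eq by blast
    have "real (k + N) \<le> real (F + Suc (Suc S)) * (call_cost - 1)"
      using FS(1) call(4) by (simp add: algebra_simps)
    moreover have "\<epsilon> * 2 ^ Suc S < norm (grad f y)"
      using FS(3) False by simp
    moreover have "\<epsilon> * 2 ^ (Suc S - 1) < m / 4 * norm (y - xstar)"
      using FS(3) call(1) by simp
    ultimately show ?thesis using IH FS(2) by blast
  qed
qed

lemma call_cost_le: "call_cost \<le> (4 + 8 * sqrt 5 * C1 c) * sqrt (L / \<mu>)"
proof -
  have C1: "0 \<le> C1 c" using c_nonneg by (simp add: C1_def)
  have \<kappa>: "1 \<le> sqrt (L / \<mu>)" using mu_le_L mu_pos by simp
  have "sqrt 10 \<le> sqrt (8\<^sup>2 * 5 :: real)" by (rule real_sqrt_le_mono) simp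
  also have "\<dots> = 8 * sqrt 5" by (simp only: real_sqrt_mult real_sqrt_abs abs_numeral)
  finally have "C1 c * (sqrt 10 * sqrt (L / \<mu>)) \<le> C1 c * (8 * sqrt 5 * sqrt (L / \<mu>))"
    using C1 \<kappa> by (intro mult_left_mono mult_right_mono) auto
  moreover have "sqrt (10 * L / \<mu>) = sqrt 10 * sqrt (L / \<mu>)"
    by (simp flip: real_sqrt_mult)
  moreover have "4 \<le> 4 * sqrt (L / \<mu>)" using \<kappa> by simp
  ultimately show ?thesis
    unfolding call_cost_def distrib_right by (simp only: mult_ac)
qed

end

lemma Suc_le_ceiling_log:
  assumes "1 < b" and "b ^ n < x"
  shows "int (Suc n) \<le> \<lceil>log b x\<rceil>"
proof -
  have "0 < x" using assms by (smt (verit) zero_less_power)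
  then have "real n < log b x"
    using assms by (simp add: less_log_iff powr_realpow)
  then show ?thesis by linarith
qed

theorem theorem5p1:
  fixes f :: "real ^ 'n \<Rightarrow> real"
    and \<A> :: "(real ^ 'n) subroutine"
    and L \<mu> \<epsilon> \<mu>0 M0 cA :: real
    and y0 xstar :: "real ^ 'n"
  assumes "smooth_with L f"
    and "\<mu> > 0" and "strongly_convex_with \<mu> f"
    and "is_arg_min f (\<lambda>_. True) xstar"
    and "cA \<ge> 0" and "subroutine_guarantee \<A> cA f L"
    and "\<epsilon> > 0" and "norm (grad f y0) > \<epsilon>"
    and "\<mu>0 \<ge> \<mu>" and "0 < M0" and "M0 \<le> 4 * L"
  shows "(\<exists>xh Mh N. SCAR \<A> f \<epsilon> y0 \<mu>0 M0 xh Mh N) \<and>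
    (\<forall>xh Mh N. SCAR \<A> f \<epsilon> y0 \<mu>0 M0 xh Mh N \<longrightarrow>
       norm (grad f xh) \<le> \<epsilon> \<and>
       real N \<le> (4 + 8 * sqrt 5 * C1 cA) * of_int \<lceil>log 4 (\<mu>0 / \<mu>)\<rceil> * sqrt (L / \<mu>)
               + (4 + 8 * sqrt 5 * C1 cA) * sqrt (L / \<mu>)
                   * of_int \<lceil>log 2 (norm (grad f y0) / \<epsilon>)\<rceil> \<and>
       (\<forall>j::int. \<mu>0 \<le> 2 powi j * \<epsilon> / norm (y0 - xstar) \<longrightarrow>
          real N \<le> (4 + 8 * sqrt 5 * C1 cA) * of_int \<lceil>log 4 (\<mu>0 / \<mu>)\<rceil> * sqrt (L / \<mu>)
                  + (4 + C1 cA * sqrt (10 * L / \<mu>)) * of_int (max 1 j)))"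
proof -
  interpret strongly_convex_subroutine f L \<mu> xstar \<A> cA
    using assms by unfold_locales
  have start: "\<mu> / 2 \<le> \<mu>0" using assms by simp
  define B where "B = (4 + 8 * sqrt 5 * C1 cA) * sqrt (L / \<mu>)"
  define K where "K = \<lceil>log 4 (\<mu>0 / \<mu>)\<rceil>"
  have cost: "0 < call_cost" "call_cost \<le> B"
  proof -
    show "0 < call_cost"
      using L_pos mu_pos c_nonneg unfolding call_cost_def C1_def
      by (intro add_pos_nonneg mult_nonneg_nonneg add_nonneg_nonneg) auto
    show "call_cost \<le> B" unfolding B_def by (rule call_cost_le)
  qed
  have bounds: "norm (grad f xh) \<le> \<epsilon> \<and>
      real N \<le> B * K + B * \<lceil>log 2 (norm (grad f y0) / \<epsilon>)\<rceil> \<and>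
      (\<forall>j::int. \<mu>0 \<le> 2 powi j * \<epsilon> / norm (y0 - xstar) \<longrightarrow>
         real N \<le> B * K + call_cost * of_int (max 1 j))"
    if SCAR: "SCAR \<A> f \<epsilon> y0 \<mu>0 M0 xh Mh N" for xh Mh N
  proof -
    obtain N' where run: "SCAR_from \<A> f \<epsilon> y0 \<mu>0 M0 xh Mh N'" and N: "N = 1 + N'"
      using SCAR by (auto simp: SCAR_def)
    obtain F S where xh: "norm (grad f xh) \<le> \<epsilon>"
      and N': "real N' \<le> real (F + Suc S) * (call_cost - 1)"
      and F: "F = 0 \<or> 2 * \<mu> * 4 ^ (F - 1) < \<mu>0"
      and S1: "\<epsilon> * 2 ^ S < norm (grad f y0)"
      and S2: "S = 0 \<or> \<epsilon> * 2 ^ (S - 1) < \<mu>0 / 4 * norm (y0 - xstar)"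
      using SCAR_from_calls[OF run start] assms by blast
    \<comment> \<open>The evaluation at the starting point is charged to the last call.\<close>
    have "real N \<le> real F * call_cost + call_cost * real (Suc S)"
      using N N' by (simp add: algebra_simps)
    moreover have "int F \<le> K"
    proof (cases F)
      case 0
      have "0 \<le> log 4 (\<mu>0 / \<mu>)" using assms by simp
      then show ?thesis unfolding K_def 0 by linarith
    next
      case (Suc n)
      have "0 < \<mu> * 4 ^ n" using mu_pos by simp
      then have "\<mu> * 4 ^ n < \<mu>0" using F Suc by (simp add: mult.assoc)
      then have "4 ^ n < \<mu>0 / \<mu>" using mu_pos by (simp add: field_simps)
      then show ?thesis using Suc_le_ceiling_log[of 4 n] by (simp add: K_def Suc)
    qed
    then have "real F * call_cost \<le> B * K"
      using cost by (subst mult.commute) (intro mult_mono; simp)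
    ultimately have total: "real N \<le> B * K + call_cost * real (Suc S)"
      by linarith
    have first: "real N \<le> B * K + B * \<lceil>log 2 (norm (grad f y0) / \<epsilon>)\<rceil>"
    proof -
      have "2 ^ S < norm (grad f y0) / \<epsilon>"
        using S1 assms by (simp add: field_simps)
      then have "int (Suc S) \<le> \<lceil>log 2 (norm (grad f y0) / \<epsilon>)\<rceil>"
        by (intro Suc_le_ceiling_log) auto
      then have "real (Suc S) \<le> of_int \<lceil>log 2 (norm (grad f y0) / \<epsilon>)\<rceil>"
        by linarith
      then have "call_cost * real (Suc S) \<le> B * \<lceil>log 2 (norm (grad f y0) / \<epsilon>)\<rceil>"
        using cost by (intro mult_mono) auto
      with total show ?thesis by linarith
    qed
    have second: "real N \<le> B * K + call_cost * of_int (max 1 j)"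
      if j: "\<mu>0 \<le> 2 powi j * \<epsilon> / norm (y0 - xstar)" for j :: int
    proof -
      have "int (Suc S) \<le> max 1 j"
      proof (cases S)
        case (Suc n)
        have "y0 \<noteq> xstar"
          using grad_at_minimizer[OF f_differentiable xstar] assms by auto
        then have "\<mu>0 * norm (y0 - xstar) \<le> 2 powi j * \<epsilon>"
          using j by (simp add: field_simps)
        then have "\<epsilon> * (4 * 2 ^ n) < \<epsilon> * 2 powi j"
          using S2 Suc by (simp add: mult_ac)
        then have "4 * 2 ^ n < (2::real) powi j"
          using assms(7) by (simp only: mult_less_cancel_left_pos)
        moreover have "(4::real) * 2 ^ n = 2 powi (int n + 2)"
          by (simp add: power_int_add)
        ultimately have "int n + 2 < j"
          by (smt (verit) power_int_increasing)
        then show ?thesis using Suc by simp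
      qed simp
      then have "real (Suc S) \<le> of_int (max 1 j)" by linarith
      then have "call_cost * real (Suc S) \<le> call_cost * of_int (max 1 j)"
        using cost by (intro mult_left_mono) auto
      with total show ?thesis by linarith
    qed
    show ?thesis using xh first second by blast
  qed
  have "\<exists>xh Mh N. SCAR \<A> f \<epsilon> y0 \<mu>0 M0 xh Mh N"
    using SCAR_from_terminates[OF _ start] assms unfolding SCAR_def by blast
  with bounds show ?thesis
    unfolding B_def K_def call_cost_def by (simp add: mult_ac)
qed

end
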